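(* Let $f\in S=\mathbb F_q[x,\sigma,\delta]$ be a W-polynomial of degree $n$ with an associated P-independent set $A=\{a_0,a_1,\ldots,a_{n-1}\}\subseteq\mathbb F_q$ (so $f$ is the minimal polynomial of $A$). Then the $(\sigma,\delta)$-Mattson–Solomon transform $$\operatorname{MS}_{(\sigma,\delta)}:(S/Sf,\bullet)\to(S/Sf,\cdot),\qquad g(x)\mapsto\sum_{i=0}^{n-1}g(a_i)x^i,$$ is an isomorphism of $S$-modules.
   Context: $\mathbb F_q$ is a finite field, $\sigma\in\operatorname{Aut}(\mathbb F_q)$, and $\delta:\mathbb F_q\to\mathbb F_q$ is additive with $\delta(ab)=\sigma(a)\delta(b)+\delta(a)b$. $S=\mathbb F_q[x,\sigma,\delta]$ is the Ore extension: polynomials with coefficients on the left, usual addition, multiplication determined by $xa=\sigma(a)x+\delta(a)$ and $x^rx^s=x^{r+s}$. Evaluation: $N_0(a)=1$, $N_{i+1}(a)=\sigma(N_i(a))a+\delta(N_i(a))$, and for $g=\sum g_ix^i\in S$, $g(a)=\sum g_iN_i(a)$ (the remainder of $g$ on right division by $x-a$). For $X\subseteq\mathbb F_q$, $I(X)=\{g\in S:g(a)=0\ \forall a\in X\}$ is a left ideal; its monic generator is the minimal polynomial of $X$. For $g\in S$, $V(g)=\{a\in\mathbb F_q:g(a)=0\}$. A monic $g$ is a Wedderburn polynomial (W-polynomial) if the minimal polynomial of $V(g)$ is $g$. An element $a$ is P-dependent on $X$ if $g(a)=0$ for every $g\in I(X)$; $X$ is P-independent if no $b\in X$ is P-dependent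 on $X\setminus\{b\}$. $S/Sf$ is identified, as an $\mathbb F_q$-space, with polynomials in $S$ of degree $<n$. $(S/Sf,\bullet)$ is the usual left $S$-module structure, $g\bullet h=gh\ (\operatorname{mod} f)$ (remainder on right division by $f$). For $a\in\mathbb F_q$ let $T_a:\mathbb F_q\to\mathbb F_q$, $T_a(b)=\sigma(b)a+\delta(b)$, and let $T:S/Sf\to S/Sf$, $T(\sum_{i=0}^{n-1}b_ix^i)=\sum_{i=0}^{n-1}T_{a_i}(b_i)x^i$. $(S/Sf,\cdot)$ is the left $S$-module structure $g\cdot v=g(T)(v)$, where $g(T)=\sum g_iT^i$ for $g=\sum g_ix^i\in S$. *)

theory Defs
  imports "HOL-Computational_Algebra.Polynomial" "HOL-Algebra.Module"
begin

section \<open>Ore extensions\<close>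

definition field_automorphism :: "('a::field \<Rightarrow> 'a) \<Rightarrow> bool" where
  "field_automorphism \<sigma> \<longleftrightarrow>
     bij \<sigma> \<and> \<sigma> 1 = 1 \<and>
     (\<forall>a b. \<sigma> (a + b) = \<sigma> a + \<sigma> b) \<and> (\<forall>a b. \<sigma> (a * b) = \<sigma> a * \<sigma> b)"

definition skew_derivation :: "('a::field \<Rightarrow> 'a) \<Rightarrow> ('a \<Rightarrow> 'a) \<Rightarrow> bool" where
  "skew_derivation \<sigma> \<delta> \<longleftrightarrow>
     (\<forall>a b. \<delta> (a + b) = \<delta> a + \<delta> b) \<and> (\<forall>a b. \<delta> (a * b) = \<sigma> a * \<delta> b + \<delta> a * b)"

text \<open>The elements of the Ore extension are ordinary polynomials, coefficients being written on
  the left; the commutative product of type \<^typ>\<open>'a poly\<close> is not used.  Left multiplication by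
  \<open>x\<close> is forced by \<open>x a = \<sigma>(a) x + \<delta>(a)\<close>: the sum of the \<open>b\<^sub>i x\<^sup>i\<close> goes to the sum of the
  \<open>\<sigma>(b\<^sub>i) x x\<^sup>i + \<delta>(b\<^sub>i) x\<^sup>i\<close>.\<close>

definition x_mult :: "('a::field \<Rightarrow> 'a) \<Rightarrow> ('a \<Rightarrow> 'a) \<Rightarrow> 'a poly \<Rightarrow> 'a poly" where
  "x_mult \<sigma> \<delta> h = pCons 0 (map_poly \<sigma> h) + map_poly \<delta> h"

definition ore_mult :: "('a::field \<Rightarrow> 'a) \<Rightarrow> ('a \<Rightarrow> 'a) \<Rightarrow> 'a poly \<Rightarrow> 'a poly \<Rightarrow> 'a poly" where
  "ore_mult \<sigma> \<delta> g h = (\<Sum>i\<le>degree g. Polynomial.smult (coeff g i) ((x_mult \<sigma> \<delta> ^^ i) h))"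

definition ore_ring :: "('a::field \<Rightarrow> 'a) \<Rightarrow> ('a \<Rightarrow> 'a) \<Rightarrow> 'a poly ring" where
  "ore_ring \<sigma> \<delta> =
     \<lparr>carrier = UNIV, mult = ore_mult \<sigma> \<delta>, one = 1, zero = 0, add = (+)\<rparr>"

section \<open>Evaluation and Wedderburn polynomials\<close>

primrec skew_norm :: "('a::field \<Rightarrow> 'a) \<Rightarrow> ('a \<Rightarrow> 'a) \<Rightarrow> nat \<Rightarrow> 'a \<Rightarrow> 'a" where
  "skew_norm \<sigma> \<delta> 0 a = 1"
| "skew_norm \<sigma> \<delta> (Suc i) a = \<sigma> (skew_norm \<sigma> \<delta> i a) * a + \<delta> (skew_norm \<sigma> \<delta> i a)"

definition skew_eval :: "('a::field \<Rightarrow> 'a) \<Rightarrow> ('a \<Rightarrow> 'a) \<Rightarrow> 'a poly \<Rightarrow> 'a \<Rightarrow> 'a" where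
  "skew_eval \<sigma> \<delta> g a = (\<Sum>i\<le>degree g. coeff g i * skew_norm \<sigma> \<delta> i a)"

definition vanishing_ideal ::
    "('a::field \<Rightarrow> 'a) \<Rightarrow> ('a \<Rightarrow> 'a) \<Rightarrow> 'a set \<Rightarrow> 'a poly set" where
  "vanishing_ideal \<sigma> \<delta> X = {g. \<forall>a\<in>X. skew_eval \<sigma> \<delta> g a = 0}"

definition zero_set :: "('a::field \<Rightarrow> 'a) \<Rightarrow> ('a \<Rightarrow> 'a) \<Rightarrow> 'a poly \<Rightarrow> 'a set" where
  "zero_set \<sigma> \<delta> g = {a. skew_eval \<sigma> \<delta> g a = 0}"

definition left_ideal_gen :: "('a::field \<Rightarrow> 'a) \<Rightarrow> ('a \<Rightarrow> 'a) \<Rightarrow> 'a poly \<Rightarrow> 'a poly set" where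
  "left_ideal_gen \<sigma> \<delta> f = {ore_mult \<sigma> \<delta> q f | q. True}"

definition is_minimal_poly ::
    "('a::field \<Rightarrow> 'a) \<Rightarrow> ('a \<Rightarrow> 'a) \<Rightarrow> 'a set \<Rightarrow> 'a poly \<Rightarrow> bool" where
  "is_minimal_poly \<sigma> \<delta> X f \<longleftrightarrow>
     lead_coeff f = 1 \<and> vanishing_ideal \<sigma> \<delta> X = left_ideal_gen \<sigma> \<delta> f"

definition W_polynomial :: "('a::field \<Rightarrow> 'a) \<Rightarrow> ('a \<Rightarrow> 'a) \<Rightarrow> 'a poly \<Rightarrow> bool" where
  "W_polynomial \<sigma> \<delta> g \<longleftrightarrow>
     lead_coeff g = 1 \<and> is_minimal_poly \<sigma> \<delta> (zero_set \<sigma> \<delta> g) g"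

definition P_dependent_on :: "('a::field \<Rightarrow> 'a) \<Rightarrow> ('a \<Rightarrow> 'a) \<Rightarrow> 'a \<Rightarrow> 'a set \<Rightarrow> bool" where
  "P_dependent_on \<sigma> \<delta> a X \<longleftrightarrow> (\<forall>g\<in>vanishing_ideal \<sigma> \<delta> X. skew_eval \<sigma> \<delta> g a = 0)"

definition P_independent :: "('a::field \<Rightarrow> 'a) \<Rightarrow> ('a \<Rightarrow> 'a) \<Rightarrow> 'a set \<Rightarrow> bool" where
  "P_independent \<sigma> \<delta> X \<longleftrightarrow> (\<forall>b\<in>X. \<not> P_dependent_on \<sigma> \<delta> b (X - {b}))"

section \<open>Left modules over a possibly noncommutative ring\<close>

text \<open>The locale \<^locale>\<open>module\<close> of the library requires a commutative ring.  Only its record type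
  is used here; the fields \<^const>\<open>mult\<close> and \<^const>\<open>one\<close> of such a record carry no meaning for a
  module.\<close>

locale left_module = R?: ring R + M?: abelian_group M
  for R :: "('r, 'b) ring_scheme" (structure) and M :: "('r, 'm, 'c) module_scheme" (structure) +
  assumes left_smult_closed:
      "\<lbrakk>r \<in> carrier R; u \<in> carrier M\<rbrakk> \<Longrightarrow> r \<odot>\<^bsub>M\<^esub> u \<in> carrier M"
    and left_smult_l_distr:
      "\<lbrakk>r \<in> carrier R; s \<in> carrier R; u \<in> carrier M\<rbrakk> \<Longrightarrow>
        (r \<oplus>\<^bsub>R\<^esub> s) \<odot>\<^bsub>M\<^esub> u = r \<odot>\<^bsub>M\<^esub> u \<oplus>\<^bsub>M\<^esub> s \<odot>\<^bsub>M\<^esub> u"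
    and left_smult_r_distr:
      "\<lbrakk>r \<in> carrier R; u \<in> carrier M; v \<in> carrier M\<rbrakk> \<Longrightarrow>
        r \<odot>\<^bsub>M\<^esub> (u \<oplus>\<^bsub>M\<^esub> v) = r \<odot>\<^bsub>M\<^esub> u \<oplus>\<^bsub>M\<^esub> r \<odot>\<^bsub>M\<^esub> v"
    and left_smult_assoc:
      "\<lbrakk>r \<in> carrier R; s \<in> carrier R; u \<in> carrier M\<rbrakk> \<Longrightarrow>
        (r \<otimes>\<^bsub>R\<^esub> s) \<odot>\<^bsub>M\<^esub> u = r \<odot>\<^bsub>M\<^esub> (s \<odot>\<^bsub>M\<^esub> u)"
    and left_smult_one:
      "u \<in> carrier M \<Longrightarrow> \<one>\<^bsub>R\<^esub> \<odot>\<^bsub>M\<^esub> u = u"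

definition left_module_iso ::
    "('r, 'b) ring_scheme \<Rightarrow> ('r, 'm, 'c) module_scheme \<Rightarrow> ('r, 'n, 'd) module_scheme \<Rightarrow>
      ('m \<Rightarrow> 'n) \<Rightarrow> bool" where
  "left_module_iso R M N \<phi> \<longleftrightarrow>
     left_module R M \<and> left_module R N \<and>
     bij_betw \<phi> (carrier M) (carrier N) \<and>
     (\<forall>u\<in>carrier M. \<forall>v\<in>carrier M. \<phi> (u \<oplus>\<^bsub>M\<^esub> v) = \<phi> u \<oplus>\<^bsub>N\<^esub> \<phi> v) \<and>
     (\<forall>r\<in>carrier R. \<forall>u\<in>carrier M. \<phi> (r \<odot>\<^bsub>M\<^esub> u) = r \<odot>\<^bsub>N\<^esub> \<phi> u)"

section \<open>The two module structures on the quotient by \<open>Sf\<close>\<close>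

text \<open>\<open>S/Sf\<close> is represented by the polynomials of degree less than \<open>n\<close>, where \<open>n\<close> is the degree
  of \<open>f\<close>.  The condition is put on the coefficients because \<open>degree 0 = 0\<close> in the library.\<close>

definition polys_below :: "nat \<Rightarrow> 'a::field poly set" where
  "polys_below n = {h. \<forall>i\<ge>n. coeff h i = 0}"

definition ore_rem :: "('a::field \<Rightarrow> 'a) \<Rightarrow> ('a \<Rightarrow> 'a) \<Rightarrow> 'a poly \<Rightarrow> 'a poly \<Rightarrow> 'a poly" where
  "ore_rem \<sigma> \<delta> f g =
     (THE r. r \<in> polys_below (degree f) \<and> (\<exists>q. g = ore_mult \<sigma> \<delta> q f + r))"

definition quotient_module ::
    "('a::field \<Rightarrow> 'a) \<Rightarrow> ('a \<Rightarrow> 'a) \<Rightarrow> 'a poly \<Rightarrow> ('a poly, 'a poly) module" where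
  "quotient_module \<sigma> \<delta> f =
     \<lparr>carrier = polys_below (degree f), mult = undefined, one = undefined, zero = 0, add = (+),
      smult = (\<lambda>g h. ore_rem \<sigma> \<delta> f (ore_mult \<sigma> \<delta> g h))\<rparr>"

definition T_elem :: "('a::field \<Rightarrow> 'a) \<Rightarrow> ('a \<Rightarrow> 'a) \<Rightarrow> 'a \<Rightarrow> 'a \<Rightarrow> 'a" where
  "T_elem \<sigma> \<delta> a b = \<sigma> b * a + \<delta> b"

definition T_map ::
    "('a::field \<Rightarrow> 'a) \<Rightarrow> ('a \<Rightarrow> 'a) \<Rightarrow> nat \<Rightarrow> (nat \<Rightarrow> 'a) \<Rightarrow> 'a poly \<Rightarrow> 'a poly" where
  "T_map \<sigma> \<delta> n a h = (\<Sum>i<n. monom (T_elem \<sigma> \<delta> (a i) (coeff h i)) i)"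

definition T_module ::
    "('a::field \<Rightarrow> 'a) \<Rightarrow> ('a \<Rightarrow> 'a) \<Rightarrow> nat \<Rightarrow> (nat \<Rightarrow> 'a) \<Rightarrow> ('a poly, 'a poly) module" where
  "T_module \<sigma> \<delta> n a =
     \<lparr>carrier = polys_below n, mult = undefined, one = undefined, zero = 0, add = (+),
      smult = (\<lambda>g v. \<Sum>i\<le>degree g. Polynomial.smult (coeff g i) ((T_map \<sigma> \<delta> n a ^^ i) v))\<rparr>"

definition MS :: "('a::field \<Rightarrow> 'a) \<Rightarrow> ('a \<Rightarrow> 'a) \<Rightarrow> nat \<Rightarrow> (nat \<Rightarrow> 'a) \<Rightarrow> 'a poly \<Rightarrow> 'a poly" where
  "MS \<sigma> \<delta> n a g = (\<Sum>i<n. monom (skew_eval \<sigma> \<delta> g (a i)) i)"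

end

(* For h in S one has (x h)(a) = T_a(h(a)), because N_i(a) = T_a^i(1) and
   T_a(b c) = \<sigma>(b) T_a(c) + \<delta>(b) c. As evaluation is left linear, MS intertwines left
   multiplication by g on S with g(T). If g has degree less than n and MS g = 0, then g lies in
   Sf, and degrees force g = 0; so MS is injective on a finite set, hence bijective. The module
   axioms for the action of T are then transported along MS from the associativity of S. *)

theory Submission
  imports Defs
begin

section \<open>Polynomials of bounded degree and coefficients of the transform\<close>

lemma zero_in_polys_below: "0 \<in> polys_below n"
  by (simp add: polys_below_def)

lemma add_in_polys_below: "g \<in> polys_below n \<Longrightarrow> h \<in> polys_below n \<Longrightarrow> g + h \<in> polys_below n"
  by (simp add: polys_below_def)

lemma uminus_in_polys_below: "g \<in> polys_below n \<Longrightarrow> - g \<in> polys_below n"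
  by (simp add: polys_below_def)

lemma diff_in_polys_below: "g \<in> polys_below n \<Longrightarrow> h \<in> polys_below n \<Longrightarrow> g - h \<in> polys_below n"
  by (simp add: polys_below_def)

text \<open>Finiteness is what later turns injectivity of the transform into bijectivity, so no
  interpolation argument has to be given.\<close>

lemma finite_polys_below: "finite (polys_below n :: 'a::{field,finite} poly set)"
proof (rule finite_subset)
  show "polys_below n \<subseteq> (Poly ` {xs :: 'a list. length xs = n})"
  proof
    fix h :: "'a poly"
    assume "h \<in> polys_below n"
    \<comment> \<open>The degree of \<open>h\<close> may be less than \<open>n - 1\<close>; since
      \<open>Poly\<close> drops trailing zeros, lists of length exactly \<open>n\<close> still reach
      every such \<open>h\<close>.\<close>
    then have "h = Poly (map (coeff h) [0..<n])"
      by (auto simp: poly_eq_iff coeff_Poly_eq nth_default_def polys_below_def)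
    then show "h \<in> Poly ` {xs. length xs = n}"
      by (rule image_eqI) simp
  qed
  show "finite (Poly ` {xs :: 'a list. length xs = n})"
    using finite_lists_length_eq[of "UNIV :: 'a set" n] by simp
qed

lemma coeff_MS: "coeff (MS \<sigma> \<delta> n a g) i = (if i < n then skew_eval \<sigma> \<delta> g (a i) else 0)"
  by (simp add: MS_def coeff_sum)

lemma coeff_T_map:
  "coeff (T_map \<sigma> \<delta> n a h) i = (if i < n then T_elem \<sigma> \<delta> (a i) (coeff h i) else 0)"
  by (simp add: T_map_def coeff_sum)

lemma MS_in_polys_below: "MS \<sigma> \<delta> n a g \<in> polys_below n"
  by (simp add: polys_below_def coeff_MS)

section \<open>Left linearity of the product, of evaluation and of the transform\<close>

lemma ore_mult_eq_sum_upto: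
  assumes "degree g \<le> N"
  shows "ore_mult \<sigma> \<delta> g h = (\<Sum>i\<le>N. Polynomial.smult (coeff g i) ((x_mult \<sigma> \<delta> ^^ i) h))"
  unfolding ore_mult_def
  by (rule sum.mono_neutral_left) (use assms in \<open>auto simp: coeff_eq_0\<close>)

lemma skew_eval_eq_sum_upto:
  assumes "degree g \<le> N"
  shows "skew_eval \<sigma> \<delta> g a = (\<Sum>i\<le>N. coeff g i * skew_norm \<sigma> \<delta> i a)"
  unfolding skew_eval_def
  by (rule sum.mono_neutral_left) (use assms in \<open>auto simp: coeff_eq_0\<close>)

lemma ore_mult_add_left:
  "ore_mult \<sigma> \<delta> (g + g') h = ore_mult \<sigma> \<delta> g h + ore_mult \<sigma> \<delta> g' h"
proof -
  \<comment> \<open>With one common bound all three sums run over the same indices, even if leading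
    terms cancel in \<open>g + g'\<close>.\<close>
  define N where "N = max (degree g) (degree g')"
  have "degree g \<le> N" "degree g' \<le> N" "degree (g + g') \<le> N"
    by (simp_all add: N_def degree_add_le_max)
  then show ?thesis
    by (simp add: ore_mult_eq_sum_upto smult_add_left sum.distrib)
qed

lemma ore_mult_smult_left:
  "ore_mult \<sigma> \<delta> (Polynomial.smult c g) h = Polynomial.smult c (ore_mult \<sigma> \<delta> g h)"
  by (subst ore_mult_eq_sum_upto[OF degree_smult_le])
    (simp add: ore_mult_def poly_eq_iff coeff_sum sum_distrib_left mult.assoc)

lemma ore_mult_zero_left: "ore_mult \<sigma> \<delta> 0 h = 0"
  by (simp add: ore_mult_def)

lemma ore_mult_one_left: "ore_mult \<sigma> \<delta> 1 h = h"
  by (simp add: ore_mult_def)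

lemma ore_mult_diff_left:
  "ore_mult \<sigma> \<delta> (g - g') h = ore_mult \<sigma> \<delta> g h - ore_mult \<sigma> \<delta> g' h"
  using ore_mult_add_left[of \<sigma> \<delta> "g - g'" g' h] by simp

lemma ore_mult_sum_left:
  "ore_mult \<sigma> \<delta> (\<Sum>i\<in>A. g i) h = (\<Sum>i\<in>A. ore_mult \<sigma> \<delta> (g i) h)"
  by (induction A rule: infinite_finite_induct)
    (simp_all add: ore_mult_zero_left ore_mult_add_left)

lemma ore_mult_monom_left:
  "ore_mult \<sigma> \<delta> (monom c k) h = Polynomial.smult c ((x_mult \<sigma> \<delta> ^^ k) h)"
  by (subst ore_mult_eq_sum_upto[OF degree_monom_le]) (simp add: if_distrib if_distribR cong: if_cong)

lemma skew_eval_zero: "skew_eval \<sigma> \<delta> 0 a = 0"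
  by (simp add: skew_eval_def)

lemma skew_eval_add: "skew_eval \<sigma> \<delta> (g + h) a = skew_eval \<sigma> \<delta> g a + skew_eval \<sigma> \<delta> h a"
proof -
  define N where "N = max (degree g) (degree h)"
  have "degree g \<le> N" "degree h \<le> N" "degree (g + h) \<le> N"
    by (simp_all add: N_def degree_add_le_max)
  then show ?thesis
    by (simp add: skew_eval_eq_sum_upto distrib_right sum.distrib)
qed

lemma skew_eval_smult: "skew_eval \<sigma> \<delta> (Polynomial.smult c g) a = c * skew_eval \<sigma> \<delta> g a"
  by (subst skew_eval_eq_sum_upto[OF degree_smult_le])
    (simp add: skew_eval_def sum_distrib_left mult.assoc)

lemma MS_zero: "MS \<sigma> \<delta> n a 0 = 0"
  by (simp add: poly_eq_iff coeff_MS skew_eval_zero)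

lemma MS_add: "MS \<sigma> \<delta> n a (g + h) = MS \<sigma> \<delta> n a g + MS \<sigma> \<delta> n a h"
  by (simp add: poly_eq_iff coeff_MS skew_eval_add)

lemma MS_smult: "MS \<sigma> \<delta> n a (Polynomial.smult c g) = Polynomial.smult c (MS \<sigma> \<delta> n a g)"
  by (simp add: poly_eq_iff coeff_MS skew_eval_smult)

lemma MS_sum: "MS \<sigma> \<delta> n a (\<Sum>i\<in>A. g i) = (\<Sum>i\<in>A. MS \<sigma> \<delta> n a (g i))"
  by (induction A rule: infinite_finite_induct) (simp_all add: MS_zero MS_add)

lemma MS_diff: "MS \<sigma> \<delta> n a (g - h) = MS \<sigma> \<delta> n a g - MS \<sigma> \<delta> n a h"
  using MS_add[of \<sigma> \<delta> n a "g - h" h] by simp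

text \<open>Both module records put polynomial addition on such a carrier, so one argument serves
  the two of them.\<close>

lemma abelian_group_polys_below:
  assumes "carrier M = polys_below n" "add M = (+)" "zero M = 0"
  shows "abelian_group M"
proof (rule abelian_groupI)
  fix g
  assume "g \<in> carrier M"
  then show "\<exists>h\<in>carrier M. h \<oplus>\<^bsub>M\<^esub> g = \<zero>\<^bsub>M\<^esub>"
    using uminus_in_polys_below[of g n] assms by (intro bexI[of _ "- g"]) auto
qed (auto simp: assms add.assoc add.commute intro: zero_in_polys_below add_in_polys_below)

section \<open>The Ore extension as an associative ring\<close>

locale ore_extension =
  fixes \<sigma> \<delta> :: "'a::field \<Rightarrow> 'a"
  assumes automorphism: "field_automorphism \<sigma>"
    and derivation: "skew_derivation \<sigma> \<delta>"
begin

abbreviation X :: "'a poly \<Rightarrow> 'a poly" where "X \<equiv> x_mult \<sigma> \<delta>"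

abbreviation ore_times :: "'a poly \<Rightarrow> 'a poly \<Rightarrow> 'a poly" (infixl "\<star>" 70)
  where "g \<star> h \<equiv> ore_mult \<sigma> \<delta> g h"

lemma sigma_one: "\<sigma> 1 = 1"
  and sigma_add: "\<sigma> (b + c) = \<sigma> b + \<sigma> c"
  and sigma_mult: "\<sigma> (b * c) = \<sigma> b * \<sigma> c"
  using automorphism by (auto simp: field_automorphism_def)

lemma delta_add: "\<delta> (b + c) = \<delta> b + \<delta> c"
  and delta_mult: "\<delta> (b * c) = \<sigma> b * \<delta> c + \<delta> b * c"
  using derivation by (auto simp: skew_derivation_def)

lemma sigma_zero: "\<sigma> 0 = 0"
  using sigma_add[of 0 0] by (metis add.right_neutral add_left_cancel)

lemma delta_zero: "\<delta> 0 = 0"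
  using delta_add[of 0 0] by (metis add.right_neutral add_left_cancel)

lemma delta_one: "\<delta> 1 = 0"
  using delta_mult[of 1 1] by (metis sigma_one mult_1 mult.right_neutral add.right_neutral add_left_cancel)

lemma coeff_X: "coeff (X h) i = (case i of 0 \<Rightarrow> 0 | Suc j \<Rightarrow> \<sigma> (coeff h j)) + \<delta> (coeff h i)"
  by (simp add: x_mult_def coeff_pCons coeff_map_poly sigma_zero delta_zero split: nat.split)

lemma X_zero: "X 0 = 0"
  by (simp add: poly_eq_iff coeff_X sigma_zero delta_zero split: nat.split)

lemma X_add: "X (g + h) = X g + X h"
  by (simp add: poly_eq_iff coeff_X sigma_add delta_add split: nat.split)

text \<open>This is the commutation rule \<open>x c = \<sigma>(c) x + \<delta>(c)\<close> applied to
  \<open>h\<close>; on coefficients it comes from multiplicativity of \<open>\<sigma>\<close> and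
  the product rule for \<open>\<delta>\<close>.\<close>

lemma X_smult:
  "X (Polynomial.smult c h) = Polynomial.smult (\<sigma> c) (X h) + Polynomial.smult (\<delta> c) h"
  by (simp add: poly_eq_iff coeff_X sigma_mult delta_mult algebra_simps split: nat.split)

lemma X_sum: "X (\<Sum>i\<in>A. g i) = (\<Sum>i\<in>A. X (g i))"
  by (induction A rule: infinite_finite_induct) (simp_all add: X_zero X_add)

lemma X_monom: "X (monom c k) = monom (\<sigma> c) (Suc k) + monom (\<delta> c) k"
  by (auto simp: poly_eq_iff coeff_X sigma_zero delta_zero split: nat.split)

lemma X_pow_add: "(X ^^ i) (g + h) = (X ^^ i) g + (X ^^ i) h"
  by (induction i) (simp_all add: X_add)

text \<open>Since \<open>\<sigma> 1 = 1\<close> and \<open>\<delta> 1 = 0\<close>, no lower terms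
  appear. This makes \<open>1\<close> a right identity.\<close>

lemma X_pow_one: "(X ^^ i) 1 = monom 1 i"
  by (induction i) (simp_all add: X_monom sigma_one delta_one)

lemma ore_mult_add_right: "g \<star> (h + k) = g \<star> h + g \<star> k"
  by (simp add: ore_mult_def X_pow_add smult_add_right sum.distrib)

lemma ore_mult_one_right: "g \<star> 1 = g"
  by (simp add: ore_mult_def X_pow_one smult_monom poly_as_sum_of_monoms)

text \<open>The case of associativity with left factor \<open>x\<close>, from which the general case
  follows. Both sides are additive in \<open>g\<close>, and for a monomial \<open>c x^k\<close> the
  claim is \<open>X_smult\<close> applied to \<open>x^k h\<close>.\<close>

lemma ore_mult_X: "X g \<star> h = X (g \<star> h)"
proof -
  have "X (monom c k) \<star> h = X (monom c k \<star> h)" for c k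
    by (simp add: X_monom ore_mult_add_left ore_mult_monom_left X_smult)
  then have "X (\<Sum>i\<le>degree g. monom (coeff g i) i) \<star> h
      = X ((\<Sum>i\<le>degree g. monom (coeff g i) i) \<star> h)"
    by (simp add: X_sum ore_mult_sum_left)
  then show ?thesis
    by (simp add: poly_as_sum_of_monoms)
qed

lemma ore_mult_X_pow: "(X ^^ i) g \<star> h = (X ^^ i) (g \<star> h)"
  by (induction i) (simp_all add: ore_mult_X)

text \<open>Expanding only the products with left factor \<open>g\<close> leaves terms
  \<open>g_i (x^i h) k\<close>, where the powers of \<open>x\<close> can be pulled out.\<close>

lemma ore_mult_assoc: "(g \<star> h) \<star> k = g \<star> (h \<star> k)"
  by (simp add: ore_mult_def[of _ _ g] ore_mult_sum_left ore_mult_smult_left ore_mult_X_pow)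

lemma ring_ore_ring: "ring (ore_ring \<sigma> \<delta>)"
proof (rule ringI)
  show "abelian_group (ore_ring \<sigma> \<delta>)"
  proof (rule abelian_groupI)
    fix g :: "'a poly"
    show "\<exists>h\<in>carrier (ore_ring \<sigma> \<delta>). h \<oplus>\<^bsub>ore_ring \<sigma> \<delta>\<^esub> g = \<zero>\<^bsub>ore_ring \<sigma> \<delta>\<^esub>"
      by (rule bexI[of _ "- g"]) (simp_all add: ore_ring_def)
  qed (simp_all add: ore_ring_def add.assoc add.commute)
  show "Group.monoid (ore_ring \<sigma> \<delta>)"
    by (rule Group.monoidI)
      (simp_all add: ore_ring_def ore_mult_assoc ore_mult_one_left ore_mult_one_right)
qed (simp_all add: ore_ring_def ore_mult_add_left ore_mult_add_right)

section \<open>Evaluation turns multiplication by x into the operator T\<close>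

lemma skew_eval_X: "skew_eval \<sigma> \<delta> (X h) b = T_elem \<sigma> \<delta> b (skew_eval \<sigma> \<delta> h b)"
proof -
  have T_add: "T_elem \<sigma> \<delta> b (c + d) = T_elem \<sigma> \<delta> b c + T_elem \<sigma> \<delta> b d" for c d
    by (simp add: T_elem_def sigma_add delta_add algebra_simps)
  have T_zero: "T_elem \<sigma> \<delta> b 0 = 0"
    by (simp add: T_elem_def sigma_zero delta_zero)
  have eval_monom: "skew_eval \<sigma> \<delta> (monom c k) b = c * skew_norm \<sigma> \<delta> k b" for c k
    by (subst skew_eval_eq_sum_upto[OF degree_monom_le])
      (simp add: if_distrib if_distribR cong: if_cong)
  have eval_sum: "skew_eval \<sigma> \<delta> (\<Sum>i\<in>A. g i) b = (\<Sum>i\<in>A. skew_eval \<sigma> \<delta> (g i) b)"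
    for A :: "nat set" and g
    by (induction A rule: infinite_finite_induct) (simp_all add: skew_eval_zero skew_eval_add)
  have T_sum: "T_elem \<sigma> \<delta> b (\<Sum>i\<in>A. u i) = (\<Sum>i\<in>A. T_elem \<sigma> \<delta> b (u i))"
    for A :: "nat set" and u
    by (induction A rule: infinite_finite_induct) (simp_all add: T_zero T_add)
  \<comment> \<open>Both sides equal \<open>\<sigma>(c) N_(k+1)(b) + \<delta>(c) N_k(b)\<close>: the
    recursion for the norms matches the product rule for \<open>T_elem\<close>. Additivity then
    extends this from monomials to all of \<open>S\<close>.\<close>
  have "skew_eval \<sigma> \<delta> (X (monom c k)) b = T_elem \<sigma> \<delta> b (skew_eval \<sigma> \<delta> (monom c k) b)" for c k
    by (simp add: X_monom skew_eval_add eval_monom T_elem_def sigma_mult delta_mult algebra_simps)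
  then have "skew_eval \<sigma> \<delta> (X (\<Sum>i\<le>degree h. monom (coeff h i) i)) b
      = T_elem \<sigma> \<delta> b (skew_eval \<sigma> \<delta> (\<Sum>i\<le>degree h. monom (coeff h i) i) b)"
    by (simp add: X_sum eval_sum T_sum)
  then show ?thesis
    by (simp add: poly_as_sum_of_monoms)
qed

lemma MS_X: "MS \<sigma> \<delta> n a (X h) = T_map \<sigma> \<delta> n a (MS \<sigma> \<delta> n a h)"
  by (simp add: poly_eq_iff coeff_MS coeff_T_map skew_eval_X)

lemma MS_X_pow: "MS \<sigma> \<delta> n a ((X ^^ i) h) = (T_map \<sigma> \<delta> n a ^^ i) (MS \<sigma> \<delta> n a h)"
  by (induction i) (simp_all add: MS_X)

text \<open>The intertwining relation already holds on all of \<open>S\<close>, before any reduction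
  modulo \<open>f\<close>. This form serves both for the module axioms of \<open>T_module\<close>
  and for linearity of the transform.\<close>

lemma MS_ore_mult: "MS \<sigma> \<delta> n a (g \<star> h) = g \<odot>\<^bsub>T_module \<sigma> \<delta> n a\<^esub> MS \<sigma> \<delta> n a h"
  by (simp add: ore_mult_def T_module_def MS_sum MS_smult MS_X_pow)

section \<open>Right division by a monic polynomial\<close>

lemma coeff_X_pow_monic:
  assumes "lead_coeff f = 1"
  shows "coeff ((X ^^ k) f) (degree f + k) = 1"
    and "degree f + k < i \<Longrightarrow> coeff ((X ^^ k) f) i = 0"
proof -
  \<comment> \<open>The two claims need a joint induction: the new top coefficient is
    \<open>\<sigma>\<close> of the old one plus \<open>\<delta>\<close> of the coefficient just
    above it, and the latter must be known to vanish.\<close>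
  have "coeff ((X ^^ k) f) (degree f + k) = 1 \<and> (\<forall>i>degree f + k. coeff ((X ^^ k) f) i = 0)"
  proof (induction k)
    case 0
    then show ?case using assms by (simp add: coeff_eq_0)
  next
    case (Suc k)
    then show ?case
      by (auto simp: coeff_X sigma_one sigma_zero delta_zero split: nat.split)
  qed
  then show "coeff ((X ^^ k) f) (degree f + k) = 1"
    and "degree f + k < i \<Longrightarrow> coeff ((X ^^ k) f) i = 0"
    by auto
qed

lemma ore_mult_monic_below_imp_zero:
  assumes "lead_coeff f = 1" and "q \<star> f \<in> polys_below (degree f)"
  shows "q = 0"
proof -
  have "coeff (q \<star> f) (degree f + degree q)
      = (\<Sum>i\<le>degree q. coeff q i * coeff ((X ^^ i) f) (degree f + degree q))"
    by (simp add: ore_mult_def coeff_sum)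
  \<comment> \<open>For \<open>i < degree q\<close> the polynomial \<open>x^i f\<close> has degree
    \<open>degree f + i\<close>, too small to contribute.\<close>
  also have "\<dots> = (\<Sum>i\<le>degree q. if i = degree q then lead_coeff q else 0)"
    by (rule sum.cong) (auto simp: coeff_X_pow_monic[OF assms(1)])
  also have "\<dots> = lead_coeff q"
    by simp
  \<comment> \<open>The index inspected is at least \<open>degree f\<close>, so the coefficient is
    zero and hence so is \<open>lead_coeff q\<close>.\<close>
  finally show ?thesis
    using assms(2) by (simp add: polys_below_def)
qed

lemma right_division_exists:
  assumes "lead_coeff f = 1"
  shows "\<exists>r. r \<in> polys_below (degree f) \<and> (\<exists>q. g = q \<star> f + r)"
proof -
  \<comment> \<open>Induction on a strict bound \<open>m\<close> for the degree treats the zero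
    polynomial and drops of more than one degree uniformly.\<close>
  have "\<exists>r. r \<in> polys_below (degree f) \<and> (\<exists>q. g = q \<star> f + r)" if "g \<in> polys_below m" for m
    using that
  proof (induction m arbitrary: g)
    case 0
    then have "g = 0"
      by (simp add: polys_below_def poly_eq_iff)
    then have "g = 0 \<star> f + 0"
      by (simp add: ore_mult_zero_left)
    then show ?case using zero_in_polys_below by blast
  next
    case (Suc m)
    show ?case
    proof (cases "degree f \<le> m")
      case False
      with Suc.prems have "g \<in> polys_below (degree f)"
        by (auto simp: polys_below_def)
      moreover have "g = 0 \<star> f + g"
        by (simp add: ore_mult_zero_left)
      ultimately show ?thesis by blast
    next
      case True
      \<comment> \<open>As \<open>f\<close> is monic, \<open>p \<star> f\<close> has the coefficient
        of \<open>g\<close> at index \<open>m\<close> and nothing above it, so subtraction lowers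
        the bound.\<close>
      define p where "p = monom (coeff g m) (m - degree f)"
      have "g - p \<star> f \<in> polys_below m"
        unfolding polys_below_def
      proof (intro CollectI allI impI)
        fix i
        assume "m \<le> i"
        then show "coeff (g - p \<star> f) i = 0"
          using Suc.prems True coeff_X_pow_monic[OF assms, of "m - degree f"]
          by (cases "i = m") (auto simp: p_def ore_mult_monom_left polys_below_def)
      qed
      then obtain r q where r: "r \<in> polys_below (degree f)" and "g - p \<star> f = q \<star> f + r"
        using Suc.IH by blast
      then have "g = (q + p) \<star> f + r"
        by (simp add: ore_mult_add_left algebra_simps)
      with r show ?thesis by blast
    qed
  qed
  moreover have "g \<in> polys_below (Suc (degree g))"
    by (simp add: polys_below_def coeff_eq_0)
  ultimately show ?thesis by blast
qed

lemma ore_rem_unique: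
  assumes monic: "lead_coeff f = 1"
    and r: "r \<in> polys_below (degree f)" and g: "g = q \<star> f + r"
  shows "ore_rem \<sigma> \<delta> f g = r"
  unfolding ore_rem_def
proof (rule the_equality)
  show "r \<in> polys_below (degree f) \<and> (\<exists>q. g = q \<star> f + r)"
    using r g by blast
  fix r'
  assume r': "r' \<in> polys_below (degree f) \<and> (\<exists>q. g = q \<star> f + r')"
  then obtain q' where "g = q' \<star> f + r'" by blast
  \<comment> \<open>The difference of two remainders is a left multiple of \<open>f\<close> of
    degree below that of \<open>f\<close>, which forces the multiplier to be zero.\<close>
  with g have diff: "(q - q') \<star> f = r' - r"
    by (simp add: ore_mult_diff_left algebra_simps)
  then have "q - q' = 0"
    using ore_mult_monic_below_imp_zero[OF monic, of "q - q'"] r r' diff_in_polys_below by auto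
  with diff show "r' = r"
    by (simp add: ore_mult_zero_left)
qed

lemma ore_rem_decomposition:
  assumes "lead_coeff f = 1"
  obtains q where "ore_rem \<sigma> \<delta> f g \<in> polys_below (degree f)" "g = q \<star> f + ore_rem \<sigma> \<delta> f g"
  using right_division_exists[OF assms, of g] ore_rem_unique[OF assms] by metis

lemma ore_rem_self:
  assumes "lead_coeff f = 1" and "g \<in> polys_below (degree f)"
  shows "ore_rem \<sigma> \<delta> f g = g"
  using ore_rem_unique[OF assms, of g 0] by (simp add: ore_mult_zero_left)

lemma ore_rem_add:
  assumes "lead_coeff f = 1"
  shows "ore_rem \<sigma> \<delta> f (g + h) = ore_rem \<sigma> \<delta> f g + ore_rem \<sigma> \<delta> f h"
proof -
  obtain p q where "ore_rem \<sigma> \<delta> f g \<in> polys_below (degree f)" "g = p \<star> f + ore_rem \<sigma> \<delta> f g"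
    and "ore_rem \<sigma> \<delta> f h \<in> polys_below (degree f)" "h = q \<star> f + ore_rem \<sigma> \<delta> f h"
    using ore_rem_decomposition[OF assms] by metis
  then show ?thesis
    by (intro ore_rem_unique[OF assms, where q = "p + q"])
      (auto simp: ore_mult_add_left algebra_simps intro: add_in_polys_below)
qed

text \<open>\<open>Sf\<close> is a left ideal: if \<open>h\<close> and its remainder differ by
  \<open>q \<star> f\<close>, then after left multiplication by \<open>g\<close> they differ by
  \<open>(g \<star> q) \<star> f\<close>. This yields associativity of the action on the
  quotient.\<close>

lemma ore_rem_ore_mult_rem:
  assumes "lead_coeff f = 1"
  shows "ore_rem \<sigma> \<delta> f (g \<star> ore_rem \<sigma> \<delta> f h) = ore_rem \<sigma> \<delta> f (g \<star> h)"
proof -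
  obtain q where q: "h = q \<star> f + ore_rem \<sigma> \<delta> f h"
    using ore_rem_decomposition[OF assms] by metis
  obtain p where p: "ore_rem \<sigma> \<delta> f (g \<star> h) \<in> polys_below (degree f)"
    "g \<star> h = p \<star> f + ore_rem \<sigma> \<delta> f (g \<star> h)"
    using ore_rem_decomposition[OF assms] by metis
  have "g \<star> h = (g \<star> q) \<star> f + g \<star> ore_rem \<sigma> \<delta> f h"
    by (subst q) (simp add: ore_mult_add_right ore_mult_assoc)
  with p(2) have "g \<star> ore_rem \<sigma> \<delta> f h = (p - g \<star> q) \<star> f + ore_rem \<sigma> \<delta> f (g \<star> h)"
    by (simp add: ore_mult_diff_left algebra_simps)
  then show ?thesis
    by (rule ore_rem_unique[OF assms p(1)])
qed

section \<open>The two left module structures\<close>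

lemma left_module_quotient_module:
  assumes monic: "lead_coeff f = 1"
  shows "left_module (ore_ring \<sigma> \<delta>) (quotient_module \<sigma> \<delta> f)"
proof -
  have rem_below: "ore_rem \<sigma> \<delta> f g \<in> polys_below (degree f)" for g
    using ore_rem_decomposition[OF monic] by metis
  have "abelian_group (quotient_module \<sigma> \<delta> f)"
    by (rule abelian_group_polys_below) (simp_all add: quotient_module_def)
  with ring_ore_ring show ?thesis
    unfolding left_module_def left_module_axioms_def
    by (simp add: quotient_module_def ore_ring_def rem_below ore_mult_add_left
        ore_mult_add_right ore_rem_add[OF monic] ore_mult_assoc ore_rem_ore_mult_rem[OF monic]
        ore_mult_one_left ore_rem_self[OF monic])
qed

text \<open>By surjectivity every vector is \<open>MS\<close> of some \<open>h\<close>, and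
  \<open>MS_ore_mult\<close> turns each axiom for the action into the corresponding ring identity in
  \<open>S\<close>.\<close>

lemma left_module_T_module:
  assumes surj: "MS \<sigma> \<delta> n a ` polys_below n = polys_below n"
  shows "left_module (ore_ring \<sigma> \<delta>) (T_module \<sigma> \<delta> n a)"
proof -
  let ?M = "T_module \<sigma> \<delta> n a"
  have carrier: "carrier ?M = polys_below n" and add: "add ?M = (+)"
    by (simp_all add: T_module_def)
  have "abelian_group ?M"
    by (rule abelian_group_polys_below) (simp_all add: T_module_def)
  moreover have "\<exists>h. v = MS \<sigma> \<delta> n a h" if "v \<in> carrier ?M" for v
    using that surj carrier by blast
  ultimately show ?thesis
    unfolding left_module_def left_module_axioms_def
    apply (intro conjI allI impI)
    subgoal by (rule ring_ore_ring)
    subgoal by assumption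
    subgoal by (metis MS_ore_mult MS_in_polys_below carrier)
    subgoal by (simp add: ore_ring_def add) (metis MS_ore_mult MS_add ore_mult_add_left)
    subgoal by (simp add: ore_ring_def add) (metis MS_ore_mult MS_add ore_mult_add_right)
    subgoal by (simp add: ore_ring_def) (metis MS_ore_mult ore_mult_assoc)
    subgoal by (simp add: ore_ring_def) (metis MS_ore_mult ore_mult_one_left)
    done
qed

section \<open>Kernel and injectivity of the transform\<close>

lemma MS_eq_zero_iff:
  assumes "is_minimal_poly \<sigma> \<delta> (a ` {..<n}) f"
  shows "MS \<sigma> \<delta> n a g = 0 \<longleftrightarrow> (\<exists>q. g = q \<star> f)"
proof -
  have "MS \<sigma> \<delta> n a g = 0 \<longleftrightarrow> g \<in> vanishing_ideal \<sigma> \<delta> (a ` {..<n})"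
    by (auto simp: poly_eq_iff coeff_MS vanishing_ideal_def)
  also have "\<dots> \<longleftrightarrow> (\<exists>q. g = q \<star> f)"
    using assms by (auto simp: is_minimal_poly_def left_ideal_gen_def)
  finally show ?thesis .
qed

text \<open>A polynomial and its remainder differ by an element of \<open>Sf\<close>, which is the
  kernel of the transform.\<close>

lemma MS_ore_rem:
  assumes "is_minimal_poly \<sigma> \<delta> (a ` {..<n}) f"
  shows "MS \<sigma> \<delta> n a (ore_rem \<sigma> \<delta> f g) = MS \<sigma> \<delta> n a g"
proof -
  have "lead_coeff f = 1"
    using assms by (simp add: is_minimal_poly_def)
  then obtain q where "g = q \<star> f + ore_rem \<sigma> \<delta> f g"
    by (rule ore_rem_decomposition)
  then have "MS \<sigma> \<delta> n a g = MS \<sigma> \<delta> n a (q \<star> f) + MS \<sigma> \<delta> n a (ore_rem \<sigma> \<delta> f g)"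
    by (metis MS_add)
  moreover have "MS \<sigma> \<delta> n a (q \<star> f) = 0"
    using MS_eq_zero_iff[OF assms] by blast
  ultimately show ?thesis by simp
qed

lemma inj_on_MS:
  assumes "is_minimal_poly \<sigma> \<delta> (a ` {..<n}) f"
  shows "inj_on (MS \<sigma> \<delta> n a) (polys_below (degree f))"
proof (rule inj_onI)
  have monic: "lead_coeff f = 1"
    using assms by (simp add: is_minimal_poly_def)
  fix g h
  assume gh: "g \<in> polys_below (degree f)" "h \<in> polys_below (degree f)"
    and "MS \<sigma> \<delta> n a g = MS \<sigma> \<delta> n a h"
  then have "MS \<sigma> \<delta> n a (g - h) = 0"
    by (simp add: MS_diff)
  then obtain q where q: "g - h = q \<star> f"
    using MS_eq_zero_iff[OF assms] by blast
  then have "q = 0"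
    using ore_mult_monic_below_imp_zero[OF monic] diff_in_polys_below[OF gh] by metis
  with q show "g = h"
    by (simp add: ore_mult_zero_left)
qed

end

theorem theorem6:
  fixes \<sigma> \<delta> :: "'a::{field,finite} \<Rightarrow> 'a"
    and f :: "'a poly" and n :: nat and a :: "nat \<Rightarrow> 'a"
  assumes "field_automorphism \<sigma>"
    and "skew_derivation \<sigma> \<delta>"
    and "W_polynomial \<sigma> \<delta> f"
    and "degree f = n"
    and "inj_on a {..<n}"
    and "P_independent \<sigma> \<delta> (a ` {..<n})"
    and "is_minimal_poly \<sigma> \<delta> (a ` {..<n}) f"
  shows "left_module_iso (ore_ring \<sigma> \<delta>) (quotient_module \<sigma> \<delta> f) (T_module \<sigma> \<delta> n a)
    (MS \<sigma> \<delta> n a)"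
proof -
  interpret ore_extension \<sigma> \<delta>
    using assms(1,2) by unfold_locales
  note minimal = \<open>is_minimal_poly \<sigma> \<delta> (a ` {..<n}) f\<close>
  have monic: "lead_coeff f = 1"
    using minimal by (simp add: is_minimal_poly_def)
  have inj: "inj_on (MS \<sigma> \<delta> n a) (polys_below n)"
    using inj_on_MS[OF minimal] \<open>degree f = n\<close> by simp
  \<comment> \<open>Since \<open>degree f = n\<close>, both carriers are the same finite set, and an
    injective self-map of it is onto.\<close>
  have surj: "MS \<sigma> \<delta> n a ` polys_below n = polys_below n"
    by (rule endo_inj_surj[OF finite_polys_below _ inj]) (auto intro: MS_in_polys_below)
  have "bij_betw (MS \<sigma> \<delta> n a) (carrier (quotient_module \<sigma> \<delta> f)) (carrier (T_module \<sigma> \<delta> n a))"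
    using inj surj \<open>degree f = n\<close> by (simp add: bij_betw_def quotient_module_def T_module_def)
  moreover have "MS \<sigma> \<delta> n a (u \<oplus>\<^bsub>quotient_module \<sigma> \<delta> f\<^esub> v)
      = MS \<sigma> \<delta> n a u \<oplus>\<^bsub>T_module \<sigma> \<delta> n a\<^esub> MS \<sigma> \<delta> n a v" for u v
    by (simp add: quotient_module_def T_module_def MS_add)
  \<comment> \<open>The remainder taken in the quotient action is invisible to \<open>MS\<close>, so
    the intertwining relation on \<open>S\<close> descends to the quotient.\<close>
  moreover have "MS \<sigma> \<delta> n a (g \<odot>\<^bsub>quotient_module \<sigma> \<delta> f\<^esub> u)
      = g \<odot>\<^bsub>T_module \<sigma> \<delta> n a\<^esub> MS \<sigma> \<delta> n a u" for g u
    by (simp add: quotient_module_def MS_ore_rem[OF minimal] MS_ore_mult)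
  ultimately show ?thesis
    unfolding left_module_iso_def
    using left_module_quotient_module[OF monic] left_module_T_module[OF surj] by blast
qed

end
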